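(* Let $A, B \in \mathcal{C}(G_n)$ be in the same path class. Then $A$ and $B$ are also in the same character class.
   Context: Let $Q_n=\{1,\dots,n\}$ be a set of $n$ yes/no questions; an outcome on $S\subseteq Q_n$ is an element of $\{0,1\}^{|S|}$, and $X_S$ is the set of outcomes on $S$. A preference matrix on $Q_n$ is a $2^n\times n$ 0-1 matrix whose rows are the $2^n$ outcomes, each exactly once, ordered from most to least preferred. For a nonempty proper $S\subset Q_n$ and outcome $x$ on $Q_n-S$, $P^{[Q_n-S,x]}$ is the submatrix formed by the columns in $S$ and rows with outcome $x$ on $Q_n-S$ (in order); $S$ is separable with respect to $P$ if $P^{[Q_n-S,x]}=P^{[Q_n-S,y]}$ for all $x,y\in X_{Q_n-S}$; $\emptyset$ and $Q_n$ are always separable. The character $\mathrm{char}(P)$ is the set of all subsets of $Q_n$ separable with respect to $P$. $\mathcal{C}(G_n)$ is the set of preference matrices generated by Hamiltonian paths in the $n$-dimensional hypercube graph $G_n$ with Gray code labeling, i.e. preference matrices in which consecutive rows differ in exactly one entry. Two characters $C_1,C_2$ are isomorphic if there is a permutation $\sigma\in S_n$ with $C_2=\{\sigma(S):S\in C_1\}$, where $\sigma(S)=\{\sigma(i):i\in S\}$; a character class is an equivalence class of preference matrices under $P_1\sim P_2$ iff $\mathrm{char}(P_1)$ and $\mathrm{char}(P_2)$ are isomorphic. Let $H_n$ be the hyperoctahedral group of $n\times n$ matrices with entries in $\{0,\pm1\}$ having exactly one nonzero entry in each row and column. For a matrix $P$ with entries in $\{0,\pm 1\}$, let $\overline{P}$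 be obtained by replacing each $0$ by $-1$ and each $-1$ by $0$. $H_n$ acts on $\mathcal{C}(G_n)$ on the right by $P\cdot M=\overline{\overline{P}M}$ (permuting columns and complementing some of them); the path classes of $G_n$ are the orbits of this action. *)

theory Defs
  imports
    "Jordan_Normal_Form.DL_Submatrix"
    "HOL-Combinatorics.Permutations"
    "HOL-Library.FuncSet"
begin

text \<open>Questions are numbered from 0, to agree with the column indices of matrices.\<close>

definition questions :: "nat \<Rightarrow> nat set" where
  "questions n = {..<n}"

definition outcomes :: "nat set \<Rightarrow> (nat \<Rightarrow> int) set" where
  "outcomes S = S \<rightarrow>\<^sub>E {0, 1}"

definition row_outcome :: "int mat \<Rightarrow> nat set \<Rightarrow> nat \<Rightarrow> (nat \<Rightarrow> int)" where
  "row_outcome P S i = (\<lambda>j\<in>S. P $$ (i, j))"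

definition preference_matrices :: "nat \<Rightarrow> int mat set" where
  "preference_matrices n = {P \<in> carrier_mat (2 ^ n) n.
     bij_betw (row_outcome P (questions n)) {..<2 ^ n} (outcomes (questions n))}"

definition conditional_matrix :: "int mat \<Rightarrow> nat set \<Rightarrow> (nat \<Rightarrow> int) \<Rightarrow> nat set \<Rightarrow> int mat" where
  "conditional_matrix P T x S = submatrix P {i. i < dim_row P \<and> row_outcome P T i = x} S"

definition separable :: "nat \<Rightarrow> int mat \<Rightarrow> nat set \<Rightarrow> bool" where
  "separable n P S \<longleftrightarrow> S = {} \<or> S = questions n \<or>
     (S \<noteq> {} \<and> S \<subset> questions n \<and>
      (\<forall>x \<in> outcomes (questions n - S). \<forall>y \<in> outcomes (questions n - S).
         conditional_matrix P (questions n - S) x S = conditional_matrix P (questions n - S) y S))"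

definition pref_char :: "nat \<Rightarrow> int mat \<Rightarrow> nat set set" where
  "pref_char n P = {S. S \<subseteq> questions n \<and> separable n P S}"

definition char_isomorphic :: "nat \<Rightarrow> nat set set \<Rightarrow> nat set set \<Rightarrow> bool" where
  "char_isomorphic n C1 C2 \<longleftrightarrow> (\<exists>\<sigma>. \<sigma> permutes questions n \<and> C2 = {\<sigma> ` S |S. S \<in> C1})"

definition char_rel :: "nat \<Rightarrow> int mat rel" where
  "char_rel n = {(P1, P2). P1 \<in> preference_matrices n \<and> P2 \<in> preference_matrices n \<and>
     char_isomorphic n (pref_char n P1) (pref_char n P2)}"

definition character_classes :: "nat \<Rightarrow> int mat set set" where
  "character_classes n = preference_matrices n // char_rel n"

definition hypercube_adj :: "nat \<Rightarrow> (nat \<Rightarrow> int) \<Rightarrow> (nat \<Rightarrow> int) \<Rightarrow> bool" where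
  "hypercube_adj n x y \<longleftrightarrow> x \<in> outcomes (questions n) \<and> y \<in> outcomes (questions n) \<and>
     card {j \<in> questions n. x j \<noteq> y j} = 1"

text \<open>The rows of a preference matrix run through every vertex of the hypercube exactly once,
  so adjacency of consecutive rows says that they trace a Hamiltonian path.\<close>

definition hamiltonian_path_matrices :: "nat \<Rightarrow> int mat set" where
  "hamiltonian_path_matrices n = {P \<in> preference_matrices n. \<forall>i. Suc i < 2 ^ n \<longrightarrow>
     hypercube_adj n (row_outcome P (questions n) i) (row_outcome P (questions n) (Suc i))}"

definition hyperoctahedral :: "nat \<Rightarrow> int mat set" where
  "hyperoctahedral n = {M \<in> carrier_mat n n.
     (\<forall>i<n. \<forall>j<n. M $$ (i, j) \<in> {-1, 0, 1}) \<and>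
     (\<forall>i<n. \<exists>!j. j < n \<and> M $$ (i, j) \<noteq> 0) \<and>
     (\<forall>j<n. \<exists>!i. i < n \<and> M $$ (i, j) \<noteq> 0)}"

text \<open>Only applied to matrices with entries in \<open>{-1, 0, 1}\<close>; the entry 1 is kept.\<close>

definition bar_mat :: "int mat \<Rightarrow> int mat" where
  "bar_mat P = map_mat (\<lambda>a. if a = 0 then -1 else if a = -1 then 0 else a) P"

definition hyperoctahedral_act :: "int mat \<Rightarrow> int mat \<Rightarrow> int mat" where
  "hyperoctahedral_act P M = bar_mat (bar_mat P * M)"

definition path_classes :: "nat \<Rightarrow> int mat set set" where
  "path_classes n =
     (\<lambda>P. hyperoctahedral_act P ` hyperoctahedral n) ` hamiltonian_path_matrices n"

end

theory Submission
  imports Defs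
begin

text \<open>
  An element of the hyperoctahedral group permutes the columns of a preference matrix and
  complements some of them, so the rows with a prescribed outcome on a set of questions are the
  rows of the original matrix with the correspondingly transported outcome. Complementing is
  injective, hence a set is separable for the new matrix iff its image under the column
  permutation is separable for the old one. Hence two matrices in one orbit are both in the
  character class of any matrix that represents the orbit.
\<close>

definition rows_with :: "int mat \<Rightarrow> nat set \<Rightarrow> (nat \<Rightarrow> int) \<Rightarrow> nat set" where
  "rows_with P T x = {i. i < dim_row P \<and> row_outcome P T i = x}"

text \<open>Both sides use the same column set \<open>J\<close>, so its numbering by
  \<open>pick J\<close> can be undone and entries compared at the columns themselves. The criterion
  ignores column order, which a permutation of columns need not preserve; only the order of the rows
  still matters.\<close>

lemma submatrix_eq_iff:
  assumes "I \<subseteq> {..<dim_row P}" "I' \<subseteq> {..<dim_row P}"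
    and "J \<subseteq> {..<dim_col P}" "J \<noteq> {}"
  shows "submatrix P I J = submatrix P I' J \<longleftrightarrow>
    card I = card I' \<and> (\<forall>a<card I. \<forall>j\<in>J. P $$ (pick I a, j) = P $$ (pick I' a, j))"
proof -
  have finJ: "finite J" using assms(3) finite_subset by blast
  have rI: "{i. i < dim_row P \<and> i \<in> I} = I" and rI': "{i. i < dim_row P \<and> i \<in> I'} = I'"
    and rJ: "{j. j < dim_col P \<and> j \<in> J} = J"
    using assms by auto
  have J: "J = pick J ` {..<card J}"
  proof
    show "J \<subseteq> pick J ` {..<card J}"
    proof
      fix j assume "j \<in> J"
      then have "pick J (card {b\<in>J. b < j}) = j" by (rule pick_card_in_set)
      moreover have "card {b\<in>J. b < j} < card J"
        using \<open>j \<in> J\<close> finJ by (intro psubset_card_mono) auto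
      ultimately show "j \<in> pick J ` {..<card J}"
        by (intro image_eqI[of _ _ "card {b\<in>J. b < j}"]) simp_all
    qed
    show "pick J ` {..<card J} \<subseteq> J" by (auto intro: pick_in_set_le)
  qed
  have ballJ: "(\<forall>j\<in>J. R j) \<longleftrightarrow> (\<forall>b<card J. R (pick J b))" for R
  proof -
    have "(\<forall>j\<in>pick J ` {..<card J}. R j) \<longleftrightarrow> (\<forall>b<card J. R (pick J b))" by auto
    then show ?thesis unfolding J[symmetric] .
  qed
  show ?thesis
    unfolding ballJ by (auto simp: mat_eq_iff submatrix_def rI rI' rJ)
qed

lemma separable_iff:
  assumes P: "P \<in> carrier_mat (2 ^ n) n"
    and S: "S \<subseteq> questions n" "S \<noteq> {}" "S \<noteq> questions n"
  shows "separable n P S \<longleftrightarrow>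
    (\<forall>x \<in> outcomes (questions n - S). \<forall>y \<in> outcomes (questions n - S).
      let I = rows_with P (questions n - S) x; I' = rows_with P (questions n - S) y
      in card I = card I' \<and> (\<forall>a<card I. \<forall>j\<in>S. P $$ (pick I a, j) = P $$ (pick I' a, j)))"
proof -
  have *: "conditional_matrix P (questions n - S) x S = conditional_matrix P (questions n - S) y S \<longleftrightarrow>
    (let I = rows_with P (questions n - S) x; I' = rows_with P (questions n - S) y
      in card I = card I' \<and> (\<forall>a<card I. \<forall>j\<in>S. P $$ (pick I a, j) = P $$ (pick I' a, j)))" for x y
    unfolding conditional_matrix_def Let_def rows_with_def
    by (rule submatrix_eq_iff) (use P S in \<open>auto simp: questions_def\<close>)
  show ?thesis using S unfolding separable_def * by auto
qed

text \<open>\<open>s j\<close> says whether the answers to question \<open>j\<close> are complemented.\<close>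

definition relabels :: "nat \<Rightarrow> (nat \<Rightarrow> nat) \<Rightarrow> (nat \<Rightarrow> bool) \<Rightarrow> int mat \<Rightarrow> int mat \<Rightarrow> bool" where
  "relabels n \<tau> s P Q \<longleftrightarrow> \<tau> permutes questions n \<and>
    P \<in> carrier_mat (2 ^ n) n \<and> Q \<in> carrier_mat (2 ^ n) n \<and>
    (\<forall>i<2 ^ n. \<forall>j<n. Q $$ (i, j) = (if s j then 1 - P $$ (i, \<tau> j) else P $$ (i, \<tau> j)))"

text \<open>Complementing is an involution. The flag for column \<open>j\<close> of \<open>P\<close>
  is the one carried by the column of \<open>Q\<close> that copies it, hence the composition with
  the inverse of \<open>\<tau>\<close>.\<close>

lemma relabels_inv:
  assumes "relabels n \<tau> s P Q"
  shows "relabels n (inv_into UNIV \<tau>) (s \<circ> inv_into UNIV \<tau>) Q P"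
proof -
  have \<tau>: "\<tau> permutes questions n" using assms by (simp add: relabels_def)
  have "inv_into UNIV \<tau> j < n" if "j < n" for j
    using permutes_in_image[OF permutes_inv[OF \<tau>], of j] that by (simp add: questions_def)
  then show ?thesis
    using assms permutes_inv[OF \<tau>] permutes_inverses(1)[OF \<tau>] by (auto simp: relabels_def)
qed

text \<open>Fixing an outcome off \<open>T\<close> in \<open>Q\<close> selects the same rows as
  fixing the transported outcome off \<open>\<tau>\<close>
  T\<open>in\<close>P\<open>. Agreement of the\<close>P\<open>-blocks on\<close>\<tau>
  \<open>T\<close> thus passes to the \<open>Q\<close>-blocks on \<open>T\<close>.\<close>

lemma relabels_separable:
  assumes rel: "relabels n \<tau> s P Q" and T: "T \<subseteq> questions n"
    and sep: "separable n P (\<tau> ` T)"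
  shows "separable n Q T"
proof (cases "T = {} \<or> T = questions n")
  case True
  then show ?thesis by (auto simp: separable_def)
next
  case False
  have \<tau>: "\<tau> permutes questions n"
    and P: "P \<in> carrier_mat (2 ^ n) n" and Q: "Q \<in> carrier_mat (2 ^ n) n"
    and QP: "\<And>i j. i < 2 ^ n \<Longrightarrow> j \<in> questions n \<Longrightarrow>
      Q $$ (i, j) = (if s j then 1 - P $$ (i, \<tau> j) else P $$ (i, \<tau> j))"
    using rel by (auto simp: relabels_def questions_def)
  have inj: "inj \<tau>" using \<tau> permutes_inj by blast
  have \<tau>T: "\<tau> ` T \<subseteq> questions n" "\<tau> ` T \<noteq> {}" "\<tau> ` T \<noteq> questions n"
    using False image_mono[OF T, of \<tau>] permutes_image[OF \<tau>] inj_image_eq_iff[OF inj, of T "questions n"]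
    by simp_all
  have compl: "questions n - \<tau> ` T = \<tau> ` (questions n - T)"
    using image_set_diff[OF inj] permutes_image[OF \<tau>] by simp
  \<comment> \<open>The transport of outcomes from \<open>Q\<close> to \<open>P\<close>. The
    restricted abstraction makes \<open>z x\<close> extensional, as membership in
    \<open>outcomes\<close> demands.\<close>
  define z where "z x = (\<lambda>k \<in> questions n - \<tau> ` T.
      if s (inv_into UNIV \<tau> k) then 1 - x (inv_into UNIV \<tau> k) else x (inv_into UNIV \<tau> k))" for x :: "nat \<Rightarrow> int"
  have z\<tau>: "z x (\<tau> j) = (if s j then 1 - x j else x j)" if "j \<in> questions n - T" for x j
    using that compl inj by (auto simp: z_def inv_f_f)
  have z: "z x \<in> outcomes (questions n - \<tau> ` T)" if "x \<in> outcomes (questions n - T)" for x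
  proof -
    have "z x (\<tau> j) \<in> {0, 1}" if "j \<in> questions n - T" for j
      using z\<tau>[OF that, of x] \<open>x \<in> outcomes (questions n - T)\<close> PiE_mem that
      unfolding outcomes_def by fastforce
    then show ?thesis
      unfolding outcomes_def compl by (auto simp: z_def compl)
  qed
  \<comment> \<open>An equality of index sets, so \<open>pick\<close> enumerates both in the same
    preference order.\<close>
  have rows: "rows_with Q (questions n - T) x = rows_with P (questions n - \<tau> ` T) (z x)"
    if x: "x \<in> outcomes (questions n - T)" for x
  proof -
    have "row_outcome Q (questions n - T) i = x \<longleftrightarrow>
        row_outcome P (questions n - \<tau> ` T) i = z x" if i: "i < 2 ^ n" for i
    proof -
      have "row_outcome Q (questions n - T) i = x \<longleftrightarrow> (\<forall>j\<in>questions n - T. Q $$ (i, j) = x j)"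
        using x by (force simp: row_outcome_def outcomes_def PiE_def extensional_def fun_eq_iff)
      also have "\<dots> \<longleftrightarrow> (\<forall>j\<in>questions n - T. P $$ (i, \<tau> j) = z x (\<tau> j))"
        using QP[OF i] z\<tau> by (intro ball_cong) auto
      also have "\<dots> \<longleftrightarrow> (\<forall>k\<in>questions n - \<tau> ` T. P $$ (i, k) = z x k)"
        unfolding compl by simp
      also have "\<dots> \<longleftrightarrow> row_outcome P (questions n - \<tau> ` T) i = z x"
        by (auto simp: row_outcome_def z_def fun_eq_iff)
      finally show ?thesis .
    qed
    then show ?thesis using P Q by (auto simp: rows_with_def)
  qed
  \<comment> \<open>\<open>QP\<close> describes only rows with index below
    \<open>2 ^ n\<close>.\<close>
  have pick_less: "pick (rows_with Q R x) a < 2 ^ n" if "a < card (rows_with Q R x)" for R x a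
    using pick_in_set_le[OF that] Q by (auto simp: rows_with_def)
  have T': "T \<noteq> {}" "T \<noteq> questions n" using False by auto
  show ?thesis
    unfolding separable_iff[OF Q T T'] Let_def
  proof (intro ballI conjI allI impI)
    fix x y assume x: "x \<in> outcomes (questions n - T)" and y: "y \<in> outcomes (questions n - T)"
    let ?I = "rows_with Q (questions n - T)"
    from sep z[OF x] z[OF y]
    have eq: "card (?I x) = card (?I y)"
      "\<forall>a<card (?I x). \<forall>j\<in>T. P $$ (pick (?I x) a, \<tau> j) = P $$ (pick (?I y) a, \<tau> j)"
      unfolding separable_iff[OF P \<tau>T] Let_def rows[OF x] rows[OF y] by blast+
    show "card (?I x) = card (?I y)" by (rule eq)
    fix a j assume a: "a < card (?I x)" and j: "j \<in> T"
    \<comment> \<open>The flag \<open>s j\<close> depends on the column alone, so both entries are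
      complemented or neither is.\<close>
    show "Q $$ (pick (?I x) a, j) = Q $$ (pick (?I y) a, j)"
      using eq(2) a j QP[OF pick_less] eq(1) T by (auto simp: subset_iff)
  qed
qed

text \<open>Column \<open>j\<close> of \<open>Q\<close> comes from column \<open>\<tau> j\<close> of
  \<open>P\<close>, so the isomorphism of characters is the inverse of \<open>\<tau>\<close>. One
  inclusion uses the relabelling itself, the other its inverse.\<close>

lemma relabels_char_isomorphic:
  assumes rel: "relabels n \<tau> s P Q"
  shows "char_isomorphic n (pref_char n P) (pref_char n Q)"
proof -
  have \<tau>: "\<tau> permutes questions n" using rel by (simp add: relabels_def)
  have inv: "inv_into UNIV \<tau> permutes questions n" by (rule permutes_inv[OF \<tau>])
  have cancel: "\<tau> ` inv_into UNIV \<tau> ` S = S" "inv_into UNIV \<tau> ` \<tau> ` S = S" for S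
    using permutes_inverses[OF \<tau>] by (auto simp: image_image)
  have sub: "\<tau> ` S \<subseteq> questions n" "inv_into UNIV \<tau> ` S \<subseteq> questions n" if "S \<subseteq> questions n" for S
    using that image_mono[OF that] permutes_image[OF \<tau>] permutes_image[OF inv] by metis+
  have "pref_char n Q = {inv_into UNIV \<tau> ` S |S. S \<in> pref_char n P}"
  proof (intro equalityI subsetI)
    fix T assume "T \<in> pref_char n Q"
    then have T: "T \<subseteq> questions n" "separable n Q T" by (auto simp: pref_char_def)
    have "separable n P (\<tau> ` T)"
      by (rule relabels_separable[OF relabels_inv[OF rel] sub(1)[OF T(1)]])
        (simp add: cancel T)
    then show "T \<in> {inv_into UNIV \<tau> ` S |S. S \<in> pref_char n P}"
      using sub(1)[OF T(1)] cancel(2)[of T] unfolding pref_char_def by blast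
  next
    fix T assume "T \<in> {inv_into UNIV \<tau> ` S |S. S \<in> pref_char n P}"
    then obtain S where S: "T = inv_into UNIV \<tau> ` S" "S \<subseteq> questions n" "separable n P S"
      by (auto simp: pref_char_def)
    then show "T \<in> pref_char n Q"
      using relabels_separable[OF rel sub(2)[OF S(2)]] sub(2)[OF S(2)]
      by (simp add: cancel pref_char_def)
  qed
  then show ?thesis using inv unfolding char_isomorphic_def by blast
qed

text \<open>Each column of \<open>M\<close> has one nonzero entry, so the product with
  \<open>M\<close> moves columns of \<open>bar_mat P\<close> and flips some signs. Under
  \<open>bar_mat\<close>, negation on -1 and 1 becomes \<open>1 - a\<close> on 0 and 1.\<close>

lemma hyperoctahedral_act_relabels:
  assumes P: "P \<in> preference_matrices n" and M: "M \<in> hyperoctahedral n"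
  shows "\<exists>\<tau> s. relabels n \<tau> s P (hyperoctahedral_act P M)"
proof -
  have Pc: "P \<in> carrier_mat (2 ^ n) n"
    and bij: "bij_betw (row_outcome P (questions n)) {..<2 ^ n} (outcomes (questions n))"
    using P by (auto simp: preference_matrices_def)
  have Mc: "M \<in> carrier_mat n n"
    and Mv: "\<And>i j. i < n \<Longrightarrow> j < n \<Longrightarrow> M $$ (i, j) \<in> {-1, 0, 1}"
    and Mr: "\<And>i. i < n \<Longrightarrow> \<exists>!j. j < n \<and> M $$ (i, j) \<noteq> 0"
    and Mk: "\<And>j. j < n \<Longrightarrow> \<exists>!i. i < n \<and> M $$ (i, j) \<noteq> 0"
    using M by (auto simp: hyperoctahedral_def)
  have P01: "P $$ (i, j) \<in> {0, 1}" if "i < 2 ^ n" "j < n" for i j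
  proof -
    have "row_outcome P (questions n) i \<in> outcomes (questions n)"
      using bij that by (auto simp: bij_betw_def)
    from PiE_mem[OF this[unfolded outcomes_def], of j] show ?thesis
      using that by (simp add: row_outcome_def questions_def)
  qed
  \<comment> \<open>The row of the nonzero entry in column \<open>j\<close>; the identity beyond
    \<open>n\<close>, as \<open>permutes\<close> requires.\<close>
  define \<tau> where "\<tau> j = (if j < n then THE i. i < n \<and> M $$ (i, j) \<noteq> 0 else j)" for j
  have \<tau>: "\<tau> j < n \<and> M $$ (\<tau> j, j) \<noteq> 0" if "j < n" for j
    using theI'[OF Mk[OF that]] that by (simp add: \<tau>_def)
  have \<tau>0: "M $$ (k, j) = 0" if "j < n" "k < n" "k \<noteq> \<tau> j" for j k
    using Mk[OF that(1)] \<tau>[OF that(1)] that by blast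
  \<comment> \<open>Two columns with the same value of \<open>\<tau>\<close> would put two nonzero
    entries into one row of \<open>M\<close>.\<close>
  have inj: "inj_on \<tau> (questions n)"
    using \<tau> Mr by (intro inj_onI) (metis lessThan_iff questions_def)
  have "\<tau> ` questions n = questions n"
    using \<tau> by (intro endo_inj_surj[OF _ _ inj]) (auto simp: questions_def)
  then have perm: "\<tau> permutes questions n"
    using inj by (intro bij_imp_permutes) (auto simp: bij_betw_def \<tau>_def questions_def)
  define s where "s j \<longleftrightarrow> M $$ (\<tau> j, j) = -1" for j
  have "hyperoctahedral_act P M $$ (i, j) = (if s j then 1 - P $$ (i, \<tau> j) else P $$ (i, \<tau> j))"
    if i: "i < 2 ^ n" and j: "j < n" for i j
  proof -
    have "(bar_mat P * M) $$ (i, j) = (\<Sum>k<n. bar_mat P $$ (i, k) * M $$ (k, j))"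
      using Pc Mc i j by (simp add: bar_mat_def scalar_prod_def lessThan_atLeast0)
    also have "\<dots> = (\<Sum>k\<in>{\<tau> j}. bar_mat P $$ (i, k) * M $$ (k, j))"
      using \<tau>[OF j] \<tau>0[OF j] by (intro sum.mono_neutral_right) auto
    \<comment> \<open>Entries of \<open>P\<close> are 0 or 1, so the barred entry is -1 or
      1.\<close>
    finally have "(bar_mat P * M) $$ (i, j) =
        (if P $$ (i, \<tau> j) = 0 then -1 else 1) * M $$ (\<tau> j, j)"
      using Pc i P01[OF i, of "\<tau> j"] \<tau>[OF j] by (auto simp: bar_mat_def)
    then show ?thesis
      using Pc Mc i j P01[OF i, of "\<tau> j"] Mv[of "\<tau> j" j] \<tau>[OF j]
      by (auto simp: hyperoctahedral_act_def bar_mat_def s_def)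
  qed
  moreover have "hyperoctahedral_act P M \<in> carrier_mat (2 ^ n) n"
    using Pc Mc by (auto simp: hyperoctahedral_act_def bar_mat_def)
  ultimately have "relabels n \<tau> s P (hyperoctahedral_act P M)"
    using perm Pc by (simp add: relabels_def)
  then show ?thesis by blast
qed

theorem theorem1:
  fixes n :: nat and A B :: "int mat"
  assumes "A \<in> hamiltonian_path_matrices n"
    and "B \<in> hamiltonian_path_matrices n"
    and "\<exists>K \<in> path_classes n. A \<in> K \<and> B \<in> K"
  shows "\<exists>K \<in> character_classes n. A \<in> K \<and> B \<in> K"
proof -
  obtain P where P: "P \<in> hamiltonian_path_matrices n"
    and AB: "A \<in> hyperoctahedral_act P ` hyperoctahedral n"
      "B \<in> hyperoctahedral_act P ` hyperoctahedral n"
    using assms(3) by (auto simp: path_classes_def)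
  have pref: "X \<in> preference_matrices n" if "X \<in> hamiltonian_path_matrices n" for X
    using that by (simp add: hamiltonian_path_matrices_def)
  \<comment> \<open>That \<open>X\<close> is a preference matrix, as \<open>char_rel\<close> asks,
    comes from \<open>X\<close> being a Hamiltonian path matrix; the action supplies only the
    isomorphism of characters.\<close>
  have "X \<in> char_rel n `` {P}"
    if "X \<in> hyperoctahedral_act P ` hyperoctahedral n" "X \<in> hamiltonian_path_matrices n" for X
    using that hyperoctahedral_act_relabels[OF pref[OF P]] relabels_char_isomorphic pref P
    by (force simp: char_rel_def)
  moreover have "char_rel n `` {P} \<in> character_classes n"
    using pref[OF P] by (auto simp: character_classes_def intro: quotientI)
  ultimately show ?thesis using AB assms(1,2) by blast
qed

end
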